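(* Let $R\subseteq T$ be rings forming a regular conductor square with conductor $C$, and set $A=R/C$, $B=T/C$. Assume that $T$ is flat as an $R$-module, that $C$ is a principal ideal of $T$, and that every non-zero 2-generated ideal $I$ of $R$ satisfies the following condition: there is an ideal $I'$ of $R$ isomorphic to $I$ (as an $R$-module) such that $I'T=T$. If $A$ is a finite conductor ring, then so are $R$ and $T$.
   Context: All rings are commutative with identity. A conductor square consists of a ring $T$, a subring $R\subseteq T$ such that $R$ and $T$ have a common non-zero ideal, the largest common ideal $C$ of $R$ and $T$ (called the conductor of $T$ into $R$), and the rings $A=R/C$ and $B=T/C$, together with the inclusions $R\hookrightarrow T$, $A\hookrightarrow B$ and the projections $\eta_2\colon R\twoheadrightarrow A$, $\eta_1\colon T\twoheadrightarrow B$; equivalently, $R$ is the pullback $\{(a,t)\in A\times T\mid a=\eta_1(t)\text{ in }B\}$ and $C=\operatorname{Ker}(\eta_1)=\operatorname{Ker}(\eta_2)$ is the largest common ideal. The square is regular if $C$ contains a non-zero-divisor of $T$. An ideal is 2-generated if it can be generated by two elements. A ring is a finite conductor ring if every 2-generated ideal of it is finitely presented. *)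

theory Defs
  imports "HOL-Algebra.Algebra" "HOL-Algebra.Free_Abelian_Groups"
begin

definition mod_hom ::
    "('r, 'x) ring_scheme \<Rightarrow> ('r, 'm) module \<Rightarrow> ('r, 'n) module \<Rightarrow> ('m \<Rightarrow> 'n) set"
  where "mod_hom R M N =
    {h. h \<in> carrier M \<rightarrow> carrier N
      \<and> (\<forall>x \<in> carrier M. \<forall>y \<in> carrier M. h (x \<oplus>\<^bsub>M\<^esub> y) = h x \<oplus>\<^bsub>N\<^esub> h y)
      \<and> (\<forall>a \<in> carrier R. \<forall>x \<in> carrier M. h (a \<odot>\<^bsub>M\<^esub> x) = a \<odot>\<^bsub>N\<^esub> h x)}"

definition module_isomorphic ::
    "('r, 'x) ring_scheme \<Rightarrow> ('r, 'm) module \<Rightarrow> ('r, 'n) module \<Rightarrow> bool"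
  where "module_isomorphic R M N \<longleftrightarrow>
    (\<exists>h \<in> mod_hom R M N. bij_betw h (carrier M) (carrier N))"

definition submodule_span ::
    "('r, 'x) ring_scheme \<Rightarrow> ('r, 'm) module \<Rightarrow> 'm set \<Rightarrow> 'm set"
  where "submodule_span R M S = \<Inter>{H. submodule H R M \<and> S \<subseteq> H}"

definition finitely_generated_submodule ::
    "('r, 'x) ring_scheme \<Rightarrow> ('r, 'm) module \<Rightarrow> 'm set \<Rightarrow> bool"
  where "finitely_generated_submodule R M N \<longleftrightarrow>
    (\<exists>S. finite S \<and> S \<subseteq> carrier M \<and> N = submodule_span R M S)"

text \<open>
  A subset \<open>S\<close> of a ring \<open>T\<close>, with the addition of \<open>T\<close> and with multiplication in \<open>T\<close> as scalar
  multiplication. It is used for an ideal \<open>S\<close> of \<open>T\<close>, as a module over \<open>T\<close>, and for \<open>S\<close> the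
  carrier of \<open>T\<close>, as a module over a subring of \<open>T\<close>.
  The \<open>mult\<close> and \<open>one\<close> fields of a module record play no role in the locale \<open>module\<close>.
\<close>

definition as_module :: "('a, 'x) ring_scheme \<Rightarrow> 'a set \<Rightarrow> ('a, 'a) module"
  where "as_module T S =
    \<lparr>carrier = S, monoid.mult = monoid.mult T, one = \<one>\<^bsub>T\<^esub>, ring.zero = \<zero>\<^bsub>T\<^esub>, ring.add = ring.add T, smult = monoid.mult T\<rparr>"

definition free_module :: "('a, 'x) ring_scheme \<Rightarrow> nat \<Rightarrow> ('a, nat \<Rightarrow> 'a) module"
  where "free_module R n =
    \<lparr>carrier = {..<n} \<rightarrow>\<^sub>E carrier R,
     monoid.mult = (\<lambda>x y. \<lambda>i\<in>{..<n}. x i \<otimes>\<^bsub>R\<^esub> y i),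
     one = (\<lambda>i\<in>{..<n}. \<one>\<^bsub>R\<^esub>),
     ring.zero = (\<lambda>i\<in>{..<n}. \<zero>\<^bsub>R\<^esub>),
     ring.add = (\<lambda>x y. \<lambda>i\<in>{..<n}. x i \<oplus>\<^bsub>R\<^esub> y i),
     smult = (\<lambda>a x. \<lambda>i\<in>{..<n}. a \<otimes>\<^bsub>R\<^esub> x i)\<rparr>"

definition finitely_presented_module :: "('a, 'x) ring_scheme \<Rightarrow> ('a, 'm) module \<Rightarrow> bool"
  where "finitely_presented_module R M \<longleftrightarrow>
    module R M \<and>
    (\<exists>n. \<exists>h \<in> mod_hom R (free_module R n) M.
       h ` carrier (free_module R n) = carrier M \<and>
       finitely_generated_submodule R (free_module R n) (a_kernel (free_module R n) M h))"

definition two_generated_ideal :: "'a set \<Rightarrow> ('a, 'x) ring_scheme \<Rightarrow> bool"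
  where "two_generated_ideal I R \<longleftrightarrow>
    (\<exists>a \<in> carrier R. \<exists>b \<in> carrier R. I = Idl\<^bsub>R\<^esub> {a, b})"

definition finite_conductor_ring :: "('a, 'x) ring_scheme \<Rightarrow> bool"
  where "finite_conductor_ring R \<longleftrightarrow>
    cring R \<and> (\<forall>I. two_generated_ideal I R \<longrightarrow> finitely_presented_module R (as_module R I))"

text \<open>
  The underlying abelian group of \<open>M \<otimes>\<^sub>R N\<close>: the free abelian group on \<open>M \<times> N\<close> modulo the
  subgroup generated by the bilinearity relations.
\<close>

definition tensor_relations ::
    "('r, 'x) ring_scheme \<Rightarrow> ('r, 'm) module \<Rightarrow> ('r, 'n) module \<Rightarrow> ('m \<times> 'n \<Rightarrow>\<^sub>0 int) set"
  where "tensor_relations R M N =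
    {frag_of (x \<oplus>\<^bsub>M\<^esub> x', y) - frag_of (x, y) - frag_of (x', y) | x x' y.
       x \<in> carrier M \<and> x' \<in> carrier M \<and> y \<in> carrier N} \<union>
    {frag_of (x, y \<oplus>\<^bsub>N\<^esub> y') - frag_of (x, y) - frag_of (x, y') | x y y'.
       x \<in> carrier M \<and> y \<in> carrier N \<and> y' \<in> carrier N} \<union>
    {frag_of (a \<odot>\<^bsub>M\<^esub> x, y) - frag_of (x, a \<odot>\<^bsub>N\<^esub> y) | a x y.
       a \<in> carrier R \<and> x \<in> carrier M \<and> y \<in> carrier N}"

definition tensor_null ::
    "('r, 'x) ring_scheme \<Rightarrow> ('r, 'm) module \<Rightarrow> ('r, 'n) module \<Rightarrow> ('m \<times> 'n \<Rightarrow>\<^sub>0 int) set"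
  where "tensor_null R M N =
    generate (free_Abelian_group (carrier M \<times> carrier N)) (tensor_relations R M N)"

definition tensor_product ::
    "('r, 'x) ring_scheme \<Rightarrow> ('r, 'm) module \<Rightarrow> ('r, 'n) module \<Rightarrow> ('m \<times> 'n \<Rightarrow>\<^sub>0 int) set monoid"
  where "tensor_product R M N =
    free_Abelian_group (carrier M \<times> carrier N) Mod tensor_null R M N"

text \<open>
  The map \<open>f \<otimes> id : M \<otimes>\<^sub>R N \<rightarrow> M' \<otimes>\<^sub>R N\<close> induced by \<open>f : M \<rightarrow> M'\<close>. It sends the class of \<open>x\<close> to the
  class of the image of \<open>x\<close> under the homomorphism of free abelian groups with
  \<open>(m, n) \<mapsto> (f m, n)\<close>; the union over all representatives \<open>x\<close> of a class is a single coset.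
\<close>

definition tensor_map ::
    "('r, 'x) ring_scheme \<Rightarrow> ('r, 'm) module \<Rightarrow> ('r, 'n) module \<Rightarrow> ('m' \<Rightarrow> 'm)
      \<Rightarrow> ('m' \<times> 'n \<Rightarrow>\<^sub>0 int) set \<Rightarrow> ('m \<times> 'n \<Rightarrow>\<^sub>0 int) set"
  where "tensor_map R M' N f K =
    (\<Union>x\<in>K. tensor_null R M' N #>\<^bsub>free_Abelian_group (carrier M' \<times> carrier N)\<^esub>
              frag_extend (\<lambda>(m, n). frag_of (f m, n)) x)"

text \<open>
  \<open>M\<close> is flat if tensoring with \<open>M\<close> preserves injectivity of \<open>R\<close>-linear maps \<open>N \<rightarrow> N'\<close>.
  HOL cannot quantify over types, so \<open>N\<close> and \<open>N'\<close> range over all modules whose elements come from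
  the element type of \<open>R\<close>. This includes all inclusions of ideals into \<open>R\<close>, and by the ideal
  criterion these already detect flatness, so the restriction does not change the notion.
\<close>

definition flat_module :: "('a, 'x) ring_scheme \<Rightarrow> ('a, 'm) module \<Rightarrow> bool"
  where "flat_module R M \<longleftrightarrow>
    module R M \<and>
    (\<forall>(N :: ('a, 'a) module) (N' :: ('a, 'a) module) f.
       module R N \<longrightarrow> module R N' \<longrightarrow> f \<in> mod_hom R N N' \<longrightarrow> inj_on f (carrier N) \<longrightarrow>
       inj_on (tensor_map R N' M f) (carrier (tensor_product R N M)))"

definition common_ideal :: "('a, 'x) ring_scheme \<Rightarrow> ('a, 'y) ring_scheme \<Rightarrow> 'a set \<Rightarrow> bool"
  where "common_ideal R T I \<longleftrightarrow> ideal I R \<and> ideal I T"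

definition is_conductor :: "('a, 'x) ring_scheme \<Rightarrow> ('a, 'y) ring_scheme \<Rightarrow> 'a set \<Rightarrow> bool"
  where "is_conductor R T C \<longleftrightarrow>
    common_ideal R T C \<and> (\<forall>I. common_ideal R T I \<longrightarrow> I \<subseteq> C)"

text \<open>
  The condition \<open>R = T\<lparr>carrier := carrier R\<rparr>\<close> says that the operations of \<open>R\<close> are those of \<open>T\<close>.
  The maps of the square are the inclusions and the canonical projections, so they are determined
  by the rings and \<open>C\<close>.
\<close>

definition conductor_square ::
    "'a ring \<Rightarrow> 'a ring \<Rightarrow> 'a set ring \<Rightarrow> 'a set ring \<Rightarrow> 'a set \<Rightarrow> bool"
  where "conductor_square R T A B C \<longleftrightarrow>
    cring T \<and>
    subring (carrier R) T \<and> R = T\<lparr>carrier := carrier R\<rparr> \<and>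
    (\<exists>I. common_ideal R T I \<and> I \<noteq> {\<zero>\<^bsub>T\<^esub>}) \<and>
    is_conductor R T C \<and>
    A = R Quot C \<and> B = T Quot C"

definition non_zero_divisor :: "('a, 'x) ring_scheme \<Rightarrow> 'a \<Rightarrow> bool"
  where "non_zero_divisor T c \<longleftrightarrow>
    c \<in> carrier T \<and> (\<forall>x \<in> carrier T. c \<otimes>\<^bsub>T\<^esub> x = \<zero>\<^bsub>T\<^esub> \<longrightarrow> x = \<zero>\<^bsub>T\<^esub>)"

definition regular_conductor_square ::
    "'a ring \<Rightarrow> 'a ring \<Rightarrow> 'a set ring \<Rightarrow> 'a set ring \<Rightarrow> 'a set \<Rightarrow> bool"
  where "regular_conductor_square R T A B C \<longleftrightarrow>
    conductor_square R T A B C \<and> (\<exists>c \<in> C. non_zero_divisor T c)"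

end

theory Submission
  imports Defs
begin

text \<open>
  The point is the syzygy module of a pair \<open>a, b\<close> of elements, not both zero, of \<open>R\<close>. The
  isomorphism from \<open>I'\<close> to \<open>I = (a, b)\<close> is multiplication by a non-zero-divisor \<open>u\<close> of \<open>T\<close>, so
  \<open>a, b\<close> have the same syzygies as \<open>a' = a / u\<close> and \<open>b' = b / u\<close>, which generate the unit ideal
  of \<open>T\<close>. Over \<open>T\<close> the syzygies of \<open>a', b'\<close> are the multiples of \<open>k = (b', - a')\<close>. Over \<open>R\<close>,
  those with entries in \<open>C\<close> are multiples of \<open>k\<close> by elements of \<open>C \<subseteq> R\<close>; and since
  \<open>C = C a' + C b'\<close>, every syzygy over \<open>A = R / C\<close> lifts to \<open>R\<close>. Hence lifts of generators over
  \<open>A\<close> together with \<open>k\<close> generate the syzygies over \<open>R\<close>. A pair in \<open>T\<close> is first multiplied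
  into \<open>C \<subseteq> R\<close> by a non-zero-divisor in \<open>C\<close>.
\<close>

section \<open>Finitely generated submodules and free modules\<close>

text \<open>Closure under negation comes from scaling by \<open>\<ominus> \<one>\<close>.\<close>

lemma (in module) submoduleI_smult:
  assumes "H \<subseteq> carrier M" "\<zero>\<^bsub>M\<^esub> \<in> H"
    and "\<And>x y. x \<in> H \<Longrightarrow> y \<in> H \<Longrightarrow> x \<oplus>\<^bsub>M\<^esub> y \<in> H"
    and "\<And>a x. a \<in> carrier R \<Longrightarrow> x \<in> H \<Longrightarrow> a \<odot>\<^bsub>M\<^esub> x \<in> H"
  shows "submodule H R M"
proof (rule submoduleI)
  fix x assume x: "x \<in> H"
  hence xM: "x \<in> carrier M" using assms(1) by blast
  have "(\<ominus> \<one>) \<odot>\<^bsub>M\<^esub> x = \<ominus>\<^bsub>M\<^esub> x" using xM by (simp add: smult_l_minus)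
  thus "\<ominus>\<^bsub>M\<^esub> x \<in> H" using assms(4)[of "\<ominus> \<one>" x] x by simp
qed (use assms in auto)

lemma (in module) submodule_zero:
  assumes "submodule H R M"
  shows "\<zero>\<^bsub>M\<^esub> \<in> H"
  using subgroup.one_closed[OF submodule.axioms(1)[OF assms]] by simp

lemma (in module) submodule_minus:
  assumes "submodule H R M" "x \<in> H" "y \<in> H"
  shows "x \<ominus>\<^bsub>M\<^esub> y \<in> H"
  unfolding a_minus_def using submoduleE[OF assms(1)] assms(2,3) by auto

text \<open>Later proofs use this form: the generators lie in \<open>N\<close> itself, and to show
  that they suffice one follows an arbitrary submodule \<open>H\<close> containing them.\<close>

lemma finitely_generated_submodule_iff:
  assumes "module R M" "submodule N R M"
  shows "finitely_generated_submodule R M N \<longleftrightarrow>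
    (\<exists>S\<subseteq>N. finite S \<and> (\<forall>H. submodule H R M \<longrightarrow> S \<subseteq> H \<longrightarrow> N \<subseteq> H))"
proof
  assume "finitely_generated_submodule R M N"
  then obtain S where "finite S" "N = \<Inter>{H. submodule H R M \<and> S \<subseteq> H}"
    unfolding finitely_generated_submodule_def submodule_span_def by auto
  thus "\<exists>S\<subseteq>N. finite S \<and> (\<forall>H. submodule H R M \<longrightarrow> S \<subseteq> H \<longrightarrow> N \<subseteq> H)" by blast
next
  assume "\<exists>S\<subseteq>N. finite S \<and> (\<forall>H. submodule H R M \<longrightarrow> S \<subseteq> H \<longrightarrow> N \<subseteq> H)"
  then obtain S where S: "S \<subseteq> N" "finite S" "\<And>H. submodule H R M \<Longrightarrow> S \<subseteq> H \<Longrightarrow> N \<subseteq> H"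
    by blast
  have "N = submodule_span R M S" unfolding submodule_span_def
    using S(1,3) assms(2) by blast
  thus "finitely_generated_submodule R M N"
    unfolding finitely_generated_submodule_def using S(1,2) module.submoduleE(1)[OF assms] by blast
qed

section \<open>Linear maps, preimages of submodules and kernels\<close>

lemma mod_homD:
  assumes "h \<in> mod_hom R M N"
  shows "x \<in> carrier M \<Longrightarrow> h x \<in> carrier N"
    and "x \<in> carrier M \<Longrightarrow> y \<in> carrier M \<Longrightarrow> h (x \<oplus>\<^bsub>M\<^esub> y) = h x \<oplus>\<^bsub>N\<^esub> h y"
    and "a \<in> carrier R \<Longrightarrow> x \<in> carrier M \<Longrightarrow> h (a \<odot>\<^bsub>M\<^esub> x) = a \<odot>\<^bsub>N\<^esub> h x"
  using assms unfolding mod_hom_def by auto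

lemma mod_hom_zero:
  assumes "module R M" "module R N" "h \<in> mod_hom R M N"
  shows "h \<zero>\<^bsub>M\<^esub> = \<zero>\<^bsub>N\<^esub>"
proof -
  interpret M: module R M by fact
  interpret N: module R N by fact
  have "h \<zero>\<^bsub>M\<^esub> = h (\<zero>\<^bsub>R\<^esub> \<odot>\<^bsub>M\<^esub> \<zero>\<^bsub>M\<^esub>)" by simp
  also have "\<dots> = \<zero>\<^bsub>R\<^esub> \<odot>\<^bsub>N\<^esub> h \<zero>\<^bsub>M\<^esub>" by (rule mod_homD(3)[OF assms(3)]) auto
  also have "\<dots> = \<zero>\<^bsub>N\<^esub>" using mod_homD(1)[OF assms(3)] by simp
  finally show ?thesis .
qed

lemma mod_hom_minus:
  assumes "module R M" "module R N" "h \<in> mod_hom R M N" "x \<in> carrier M" "y \<in> carrier M"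
  shows "h (x \<ominus>\<^bsub>M\<^esub> y) = h x \<ominus>\<^bsub>N\<^esub> h y"
proof -
  interpret M: module R M by fact
  interpret N: module R N by fact
  note h = mod_homD[OF assms(3)]
  have "h (\<ominus>\<^bsub>M\<^esub> y) = h ((\<ominus>\<^bsub>R\<^esub> \<one>\<^bsub>R\<^esub>) \<odot>\<^bsub>M\<^esub> y)"
    using assms(5) by (simp add: M.smult_l_minus)
  also have "\<dots> = \<ominus>\<^bsub>N\<^esub> h y" using assms(5) h by (simp add: N.smult_l_minus)
  finally show ?thesis using assms(4,5) h by (simp add: a_minus_def)
qed

lemma mod_hom_compose:
  assumes "f \<in> mod_hom R M N" "g \<in> mod_hom R N P"
  shows "(\<lambda>x. g (f x)) \<in> mod_hom R M P"
  using assms unfolding mod_hom_def by (auto simp: Pi_iff)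

lemma mod_hom_diff:
  assumes "module R M" "module R N" "f \<in> mod_hom R M N" "g \<in> mod_hom R M N"
  shows "(\<lambda>x. f x \<ominus>\<^bsub>N\<^esub> g x) \<in> mod_hom R M N"
proof -
  interpret N: module R N by fact
  note f = mod_homD[OF assms(3)] and g = mod_homD[OF assms(4)]
  show ?thesis unfolding mod_hom_def a_minus_def
    by (auto simp: f g N.M.minus_add N.M.a_ac N.smult_r_distr N.smult_r_minus)
qed

lemma mod_hom_id: "(\<lambda>x. x) \<in> mod_hom R M M"
  by (simp add: mod_hom_def)

text \<open>Transports generators along a linear map: once the preimage of \<open>H\<close> contains
  generators of a submodule, the map sends that whole submodule into \<open>H\<close>.\<close>

lemma submodule_vimage:
  assumes "module R M" "module R N" "h \<in> mod_hom R M N" "submodule H R N"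
  shows "submodule {x \<in> carrier M. h x \<in> H} R M"
proof -
  interpret M: module R M by fact
  interpret N: module R N by fact
  note h = mod_homD[OF assms(3)] and H = N.submoduleE[OF assms(4)]
  show ?thesis
    by (rule M.submoduleI_smult)
      (auto simp: h mod_hom_zero[OF assms(1-3)] N.submodule_zero[OF assms(4)] H)
qed

lemma (in module) submodule_zero_set: "submodule {\<zero>\<^bsub>M\<^esub>} R M"
  by (rule submoduleI_smult) auto

lemma a_kernel_eq: "a_kernel M N h = {x \<in> carrier M. h x = \<zero>\<^bsub>N\<^esub>}"
  unfolding a_kernel_def kernel_def by simp

lemma submodule_a_kernel:
  assumes "module R M" "module R N" "h \<in> mod_hom R M N"
  shows "submodule (a_kernel M N h) R M"
  using submodule_vimage[OF assms module.submodule_zero_set[OF assms(2)]]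
  by (simp add: a_kernel_eq)

section \<open>Free modules of finite rank and maps out of them\<close>

lemma free_module_simps:
  "carrier (free_module R n) = {..<n} \<rightarrow>\<^sub>E carrier R"
  "\<zero>\<^bsub>free_module R n\<^esub> = (\<lambda>i\<in>{..<n}. \<zero>\<^bsub>R\<^esub>)"
  "x \<oplus>\<^bsub>free_module R n\<^esub> y = (\<lambda>i\<in>{..<n}. x i \<oplus>\<^bsub>R\<^esub> y i)"
  "a \<odot>\<^bsub>free_module R n\<^esub> x = (\<lambda>i\<in>{..<n}. a \<otimes>\<^bsub>R\<^esub> x i)"
  by (simp_all add: free_module_def)

lemma free_module_eqI:
  assumes "x \<in> carrier (free_module R n)" "y \<in> carrier (free_module R n)"
    and "\<And>i. i < n \<Longrightarrow> x i = y i"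
  shows "x = y"
  using assms by (intro PiE_ext[of x "{..<n}" "\<lambda>_. carrier R"]) (auto simp: free_module_simps)

lemma free_module_nth_closed:
  "x \<in> carrier (free_module R n) \<Longrightarrow> i < n \<Longrightarrow> x i \<in> carrier R"
  by (auto simp: free_module_simps)

lemma free_module_nth:
  assumes "i < n"
  shows "\<zero>\<^bsub>free_module R n\<^esub> i = \<zero>\<^bsub>R\<^esub>"
    and "(x \<oplus>\<^bsub>free_module R n\<^esub> y) i = x i \<oplus>\<^bsub>R\<^esub> y i"
    and "(a \<odot>\<^bsub>free_module R n\<^esub> x) i = a \<otimes>\<^bsub>R\<^esub> x i"
  using assms by (simp_all add: free_module_simps)

lemma (in cring) free_module_closed:
  "\<zero>\<^bsub>free_module R n\<^esub> \<in> carrier (free_module R n)"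
  "x \<in> carrier (free_module R n) \<Longrightarrow> y \<in> carrier (free_module R n) \<Longrightarrow>
    x \<oplus>\<^bsub>free_module R n\<^esub> y \<in> carrier (free_module R n)"
  "a \<in> carrier R \<Longrightarrow> x \<in> carrier (free_module R n) \<Longrightarrow>
    a \<odot>\<^bsub>free_module R n\<^esub> x \<in> carrier (free_module R n)"
  by (auto simp: free_module_simps)

lemma (in cring) free_module_module: "module R (free_module R n)"
proof (rule moduleI)
  note [simp] = free_module_nth free_module_nth_closed free_module_closed
  show "abelian_group (free_module R n)"
  proof (rule abelian_groupI)
    fix x assume x: "x \<in> carrier (free_module R n)"
    have m: "(\<lambda>i\<in>{..<n}. \<ominus> x i) \<in> carrier (free_module R n)"
      using x by (auto simp: free_module_simps)
    have "(\<lambda>i\<in>{..<n}. \<ominus> x i) \<oplus>\<^bsub>free_module R n\<^esub> x = \<zero>\<^bsub>free_module R n\<^esub>"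
      using x m by (intro free_module_eqI[where R = R and n = n]) (auto simp: l_neg)
    thus "\<exists>y\<in>carrier (free_module R n). y \<oplus>\<^bsub>free_module R n\<^esub> x = \<zero>\<^bsub>free_module R n\<^esub>"
      using m by blast
  qed (auto intro!: free_module_eqI[where R = R and n = n] simp: a_ac)
qed (auto intro!: free_module_eqI[where R = R and n = n]
    simp: l_distr r_distr m_assoc is_cring free_module_nth free_module_nth_closed free_module_closed)

definition unit_vec :: "('a, 'x) ring_scheme \<Rightarrow> nat \<Rightarrow> nat \<Rightarrow> nat \<Rightarrow> 'a"
  where "unit_vec R n i = (\<lambda>j\<in>{..<n}. if i = j then \<one>\<^bsub>R\<^esub> else \<zero>\<^bsub>R\<^esub>)"

lemma (in cring) unit_vec_closed: "unit_vec R n i \<in> carrier (free_module R n)"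
  by (auto simp: unit_vec_def free_module_simps)

text \<open>A vector is built up one coordinate at a time, by induction on a bound \<open>k\<close>
  from which on all coordinates vanish. Statements about linear maps on a free module thus reduce to
  the unit vectors without any finite sums.\<close>

lemma (in cring) submodule_unit_vec:
  assumes H: "submodule H R (free_module R n)" and e: "\<And>i. i < n \<Longrightarrow> unit_vec R n i \<in> H"
  shows "H = carrier (free_module R n)"
proof
  interpret F: module R "free_module R n" by (rule free_module_module)
  note HE = F.submoduleE[OF H]
  show "H \<subseteq> carrier (free_module R n)" by (rule HE)
  have "x \<in> H" if "x \<in> carrier (free_module R n)" "\<And>i. k \<le> i \<Longrightarrow> i < n \<Longrightarrow> x i = \<zero>" "k \<le> n"
    for k x
    using that
  proof (induction k arbitrary: x)
    case 0
    hence "x = \<zero>\<^bsub>free_module R n\<^esub>"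
      by (intro free_module_eqI[where R = R and n = n]) (auto simp: free_module_nth)
    thus ?case using F.submodule_zero[OF H] by simp
  next
    case (Suc k)
    \<comment> \<open>\<open>?y\<close> is \<open>x\<close> with coordinate \<open>k\<close> erased,
      so it vanishes from \<open>k\<close> on and the induction hypothesis applies.\<close>
    let ?y = "\<lambda>i\<in>{..<n}. if i = k then \<zero> else x i"
    have xk: "x k \<in> carrier R"
      using free_module_nth_closed[OF Suc.prems(1)] Suc.prems(3) by simp
    have y: "?y \<in> carrier (free_module R n)"
      using free_module_nth_closed[OF Suc.prems(1)] by (simp add: free_module_simps)
    have "?y \<in> H"
    proof (rule Suc.IH[OF y])
      fix i assume "k \<le> i" "i < n"
      thus "?y i = \<zero>" using Suc.prems(2)[of i] by (cases "i = k") auto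
    qed (use Suc.prems(3) in simp)
    moreover have "x k \<odot>\<^bsub>free_module R n\<^esub> unit_vec R n k \<in> H"
      using HE(4)[OF xk] e Suc.prems(3) by simp
    moreover have "x = ?y \<oplus>\<^bsub>free_module R n\<^esub> (x k \<odot>\<^bsub>free_module R n\<^esub> unit_vec R n k)"
    proof (rule free_module_eqI[where R = R and n = n])
      fix i assume "i < n"
      thus "x i = (?y \<oplus>\<^bsub>free_module R n\<^esub> (x k \<odot>\<^bsub>free_module R n\<^esub> unit_vec R n k)) i"
        using xk free_module_nth_closed[OF Suc.prems(1), of i]
        by (auto simp: free_module_nth unit_vec_def)
    qed (intro free_module_closed Suc.prems(1) y xk unit_vec_closed)+
    ultimately show ?case using HE(5) by metis
  qed
  from this[of _ n] show "carrier (free_module R n) \<subseteq> H" by auto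
qed

text \<open>The existence half of the universal property: \<open>f\<close> sends \<open>x\<close> to
  the linear combination of the \<open>u i\<close> with coefficients \<open>x i\<close>.\<close>

lemma free_module_hom_ex:
  assumes "module R M" "u \<in> {..<n} \<rightarrow> carrier M"
  obtains f where "f \<in> mod_hom R (free_module R n) M" "\<And>i. i < n \<Longrightarrow> f (unit_vec R n i) = u i"
proof
  interpret module R M by fact
  let ?f = "\<lambda>x. \<Oplus>\<^bsub>M\<^esub>i\<in>{..<n}. x i \<odot>\<^bsub>M\<^esub> u i"
  have cl: "x i \<odot>\<^bsub>M\<^esub> u i \<in> carrier M" if "x \<in> {..<n} \<rightarrow>\<^sub>E carrier R" "i < n" for x i
    using that assms(2) by (intro smult_closed) auto
  show "?f \<in> mod_hom R (free_module R n) M"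
    unfolding mod_hom_def
  proof (safe)
    fix x assume x: "x \<in> carrier (free_module R n)"
    hence x': "x \<in> {..<n} \<rightarrow>\<^sub>E carrier R" by (simp add: free_module_simps)
    show "?f x \<in> carrier M" using cl[OF x'] by (intro M.finsum_closed) auto
    { fix y assume y: "y \<in> carrier (free_module R n)"
      hence y': "y \<in> {..<n} \<rightarrow>\<^sub>E carrier R" by (simp add: free_module_simps)
      have "?f (x \<oplus>\<^bsub>free_module R n\<^esub> y)
          = (\<Oplus>\<^bsub>M\<^esub>i\<in>{..<n}. x i \<odot>\<^bsub>M\<^esub> u i \<oplus>\<^bsub>M\<^esub> y i \<odot>\<^bsub>M\<^esub> u i)"
      proof (rule M.finsum_cong')
        fix i assume i: "i \<in> {..<n}"
        hence "x i \<in> carrier R" "y i \<in> carrier R" "u i \<in> carrier M"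
          using x' y' assms(2) by auto
        thus "(x \<oplus>\<^bsub>free_module R n\<^esub> y) i \<odot>\<^bsub>M\<^esub> u i = x i \<odot>\<^bsub>M\<^esub> u i \<oplus>\<^bsub>M\<^esub> y i \<odot>\<^bsub>M\<^esub> u i"
          using i by (simp add: free_module_simps smult_l_distr)
      qed (use cl[OF x'] cl[OF y'] in auto)
      also have "\<dots> = ?f x \<oplus>\<^bsub>M\<^esub> ?f y"
        using cl[OF x'] cl[OF y'] by (intro M.finsum_addf) auto
      finally show "?f (x \<oplus>\<^bsub>free_module R n\<^esub> y) = ?f x \<oplus>\<^bsub>M\<^esub> ?f y" . }
    fix a assume a: "a \<in> carrier R"
    have "a \<odot>\<^bsub>M\<^esub> ?f x = (\<Oplus>\<^bsub>M\<^esub>i\<in>{..<n}. a \<odot>\<^bsub>M\<^esub> (x i \<odot>\<^bsub>M\<^esub> u i))"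
      using a cl[OF x'] by (intro finsum_smult_ldistr) auto
    also have "\<dots> = ?f (a \<odot>\<^bsub>free_module R n\<^esub> x)"
    proof (rule M.finsum_cong')
      fix i assume i: "i \<in> {..<n}"
      hence "x i \<in> carrier R" "u i \<in> carrier M"
        using x' assms(2) by auto
      thus "a \<odot>\<^bsub>M\<^esub> (x i \<odot>\<^bsub>M\<^esub> u i) = (a \<odot>\<^bsub>free_module R n\<^esub> x) i \<odot>\<^bsub>M\<^esub> u i"
        using i a by (simp add: free_module_simps smult_assoc1)
    next
      show "(\<lambda>i. (a \<odot>\<^bsub>free_module R n\<^esub> x) i \<odot>\<^bsub>M\<^esub> u i) \<in> {..<n} \<rightarrow> carrier M"
        using x' assms(2) a by (auto simp: free_module_simps intro!: smult_closed m_closed)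
    qed simp
    finally show "?f (a \<odot>\<^bsub>free_module R n\<^esub> x) = a \<odot>\<^bsub>M\<^esub> ?f x" ..
  qed
  fix i assume i: "i < n"
  have "?f (unit_vec R n i) = (\<Oplus>\<^bsub>M\<^esub>j\<in>{..<n}. if i = j then u j else \<zero>\<^bsub>M\<^esub>)"
    using assms(2) by (intro M.finsum_cong') (auto simp: unit_vec_def Pi_iff)
  also have "\<dots> = u i" using i assms(2) by (intro M.finsum_singleton) auto
  finally show "?f (unit_vec R n i) = u i" .
qed

text \<open>Free modules are projective: choose preimages of the images of the unit vectors and
  extend linearly. The kernel of the difference of \<open>h \<circ> f\<close> and \<open>g\<close>
  contains the unit vectors, so it is everything.\<close>

lemma free_module_lift:
  assumes "module R M" "module R N" "h \<in> mod_hom R M N" "h ` carrier M = carrier N"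
    and "g \<in> mod_hom R (free_module R n) N"
  obtains f where "f \<in> mod_hom R (free_module R n) M"
    "\<And>x. x \<in> carrier (free_module R n) \<Longrightarrow> h (f x) = g x"
proof -
  interpret N: module R N by fact
  interpret F: module R "free_module R n" by (rule N.free_module_module)
  \<comment> \<open>For \<open>i \<ge> n\<close> the vector \<open>unit_vec R n i\<close> is zero,
    so preimages can be chosen for all indices at once.\<close>
  have "\<exists>v\<in>carrier M. h v = g (unit_vec R n i)" for i
    using mod_homD(1)[OF assms(5) N.unit_vec_closed[of n i]] assms(4) by (metis imageE)
  then obtain u where u: "\<And>i. u i \<in> carrier M" "\<And>i. h (u i) = g (unit_vec R n i)" by metis
  obtain f where f: "f \<in> mod_hom R (free_module R n) M"
    "\<And>i. i < n \<Longrightarrow> f (unit_vec R n i) = u i"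
    using free_module_hom_ex[OF assms(1), of u n] u by blast
  have d: "(\<lambda>x. h (f x) \<ominus>\<^bsub>N\<^esub> g x) \<in> mod_hom R (free_module R n) N"
    by (rule mod_hom_diff[OF F.module_axioms assms(2) mod_hom_compose[OF f(1) assms(3)] assms(5)])
  let ?K = "a_kernel (free_module R n) N (\<lambda>x. h (f x) \<ominus>\<^bsub>N\<^esub> g x)"
  have "?K = carrier (free_module R n)"
  proof (rule N.submodule_unit_vec)
    show "submodule ?K R (free_module R n)"
      by (rule submodule_a_kernel[OF F.module_axioms assms(2) d])
    fix i assume "i < n"
    thus "unit_vec R n i \<in> ?K"
      using f(2) u mod_homD(1)[OF assms(5) N.unit_vec_closed[of n i]] N.unit_vec_closed[of n i]
      by (simp add: a_kernel_eq a_minus_def N.M.r_neg)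
  qed
  hence "h (f x) \<ominus>\<^bsub>N\<^esub> g x = \<zero>\<^bsub>N\<^esub>" if "x \<in> carrier (free_module R n)" for x
    using that by (auto simp: a_kernel_eq)
  hence "h (f x) = g x" if "x \<in> carrier (free_module R n)" for x
    using that mod_homD(1)[OF f(1)] mod_homD(1)[OF assms(3)] mod_homD(1)[OF assms(5)]
    by (metis N.M.minus_equality N.M.minus_minus N.M.a_inv_closed a_minus_def)
  with f(1) show thesis by (rule that)
qed

text \<open>
  Schanuel's argument: for lifts \<open>\<phi>\<close>, \<open>\<psi>\<close> between the two presentations, split
  \<open>x = (x - \<psi> (\<phi> x)) + \<psi> (\<phi> x)\<close>.
\<close>

lemma finitely_presented_kernel:
  assumes fp: "finitely_presented_module R M"
    and g: "g \<in> mod_hom R (free_module R m) M" "g ` carrier (free_module R m) = carrier M"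
  shows "finitely_generated_submodule R (free_module R m) (a_kernel (free_module R m) M g)"
proof -
  obtain n h where M: "module R M" and h: "h \<in> mod_hom R (free_module R n) M"
    "h ` carrier (free_module R n) = carrier M"
    and fg: "finitely_generated_submodule R (free_module R n) (a_kernel (free_module R n) M h)"
    using fp unfolding finitely_presented_module_def by blast
  interpret M: module R M by fact
  interpret F: module R "free_module R m" by (rule M.free_module_module)
  interpret G: module R "free_module R n" by (rule M.free_module_module)
  let ?F = "free_module R m" and ?G = "free_module R n"
  note Kh = submodule_a_kernel[OF G.module_axioms M h(1)]
  note Kg = submodule_a_kernel[OF F.module_axioms M g(1)]
  obtain S where S: "S \<subseteq> a_kernel ?G M h" "finite S"
    "\<And>H. submodule H R ?G \<Longrightarrow> S \<subseteq> H \<Longrightarrow> a_kernel ?G M h \<subseteq> H"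
    using fg unfolding finitely_generated_submodule_iff[OF G.module_axioms Kh] by blast
  obtain \<phi> where phi: "\<phi> \<in> mod_hom R ?F ?G" "\<And>x. x \<in> carrier ?F \<Longrightarrow> h (\<phi> x) = g x"
    using free_module_lift[OF G.module_axioms M h g(1)] by blast
  obtain \<psi> where psi: "\<psi> \<in> mod_hom R ?G ?F" "\<And>x. x \<in> carrier ?G \<Longrightarrow> g (\<psi> x) = h x"
    using free_module_lift[OF F.module_axioms M g h(1)] by blast
  \<comment> \<open>\<open>d\<close> measures how far \<open>\<psi> \<circ> \<phi>\<close> is from
    the identity. It takes values in the kernel of \<open>g\<close>, since \<open>g\<close> after
    \<open>\<psi> \<circ> \<phi>\<close> equals \<open>h \<circ> \<phi>\<close>, which is
    \<open>g\<close>.\<close>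
  define d where "d = (\<lambda>x. x \<ominus>\<^bsub>?F\<^esub> \<psi> (\<phi> x))"
  have d: "d \<in> mod_hom R ?F ?F" unfolding d_def
    by (rule mod_hom_diff[OF F.module_axioms F.module_axioms mod_hom_id
          mod_hom_compose[OF phi(1) psi(1)]])
  note phic = mod_homD(1)[OF phi(1)] and psic = mod_homD(1)[OF psi(1)] and dc = mod_homD(1)[OF d]
  have gd: "g (d x) = \<zero>\<^bsub>M\<^esub>" if "x \<in> carrier ?F" for x
  proof -
    have "g (d x) = g x \<ominus>\<^bsub>M\<^esub> g (\<psi> (\<phi> x))"
      unfolding d_def using that phic psic by (intro mod_hom_minus[OF F.module_axioms M g(1)]) auto
    also have "g (\<psi> (\<phi> x)) = g x" using that phi(2) psi(2) phic by simp
    finally show ?thesis using that mod_homD(1)[OF g(1)] by (simp add: a_minus_def M.M.r_neg)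
  qed
  \<comment> \<open>The first set generates the image of \<open>d\<close>; the second generates the
    image under \<open>\<psi>\<close> of the kernel of \<open>h\<close>.\<close>
  let ?S = "d ` unit_vec R m ` {..<m} \<union> \<psi> ` S"
  show ?thesis unfolding finitely_generated_submodule_iff[OF F.module_axioms Kg]
  proof (intro exI[of _ ?S] conjI allI impI subsetI)
    fix x assume "x \<in> ?S"
    thus "x \<in> a_kernel ?F M g"
      using S(1) gd dc psi(2) psic M.unit_vec_closed by (auto simp: a_kernel_eq)
  next
    fix H x assume H: "submodule H R ?F" "?S \<subseteq> H" and x: "x \<in> a_kernel ?F M g"
    have xc: "x \<in> carrier ?F" "g x = \<zero>\<^bsub>M\<^esub>" using x by (auto simp: a_kernel_eq)
    have "{x \<in> carrier ?F. d x \<in> H} = carrier ?F"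
      using H(2) M.unit_vec_closed
      by (intro M.submodule_unit_vec submodule_vimage[OF F.module_axioms F.module_axioms d H(1)])
        auto
    hence 1: "d x \<in> H" using xc by blast
    have "a_kernel ?G M h \<subseteq> {x \<in> carrier ?G. \<psi> x \<in> H}"
      using H(2) S(1)
      by (intro S(3) submodule_vimage[OF G.module_axioms F.module_axioms psi(1) H(1)])
        (auto simp: a_kernel_eq)
    \<comment> \<open>As \<open>x\<close> is in the kernel of \<open>g\<close>, its lift
      \<open>\<phi> x\<close> is in the kernel of \<open>h\<close>, so the second summand of the
      splitting lies in \<open>H\<close> too.\<close>
    moreover have "\<phi> x \<in> a_kernel ?G M h" using xc phi(2) phic by (simp add: a_kernel_eq)
    ultimately have "d x \<oplus>\<^bsub>?F\<^esub> \<psi> (\<phi> x) \<in> H"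
      using 1 F.submoduleE(5)[OF H(1)] by blast
    moreover have "d x \<oplus>\<^bsub>?F\<^esub> \<psi> (\<phi> x) = x"
      unfolding d_def a_minus_def using xc phic psic by (simp add: F.M.a_assoc F.M.l_neg)
    ultimately show "x \<in> H" by simp
  qed (use S(2) in auto)
qed


section \<open>Ideals with two generators and their syzygies\<close>

lemma as_module_simps:
  "carrier (as_module R I) = I" "\<zero>\<^bsub>as_module R I\<^esub> = \<zero>\<^bsub>R\<^esub>"
  "x \<oplus>\<^bsub>as_module R I\<^esub> y = x \<oplus>\<^bsub>R\<^esub> y" "a \<odot>\<^bsub>as_module R I\<^esub> x = a \<otimes>\<^bsub>R\<^esub> x"
  by (simp_all add: as_module_def)

lemma (in cring) as_module_ideal:
  assumes "ideal I R"
  shows "module R (as_module R I)"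
proof -
  interpret I: ideal I R by fact
  have [simp]: "x \<in> I \<Longrightarrow> x \<in> carrier R" for x using I.a_subset by blast
  show ?thesis
  proof (rule moduleI)
    show "abelian_group (as_module R I)"
    proof (rule abelian_groupI)
      fix x assume "x \<in> carrier (as_module R I)"
      thus "\<exists>y\<in>carrier (as_module R I). y \<oplus>\<^bsub>as_module R I\<^esub> x = \<zero>\<^bsub>as_module R I\<^esub>"
        by (intro bexI[of _ "\<ominus> x"]) (auto simp: as_module_simps l_neg)
    qed (auto simp: as_module_simps a_ac)
  qed (auto simp: as_module_simps l_distr r_distr m_assoc is_cring I.I_l_closed)
qed

lemma (in cring) genideal_pair:
  assumes "a \<in> carrier R" "b \<in> carrier R"
  shows "Idl {a, b} = {x \<otimes> a \<oplus> y \<otimes> b | x y. x \<in> carrier R \<and> y \<in> carrier R}" (is "_ = ?J")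
proof
  have J: "ideal ?J R"
  proof (rule idealI[OF ring_axioms])
    show "subgroup ?J (add_monoid R)"
    proof (rule add.subgroupI)
      show "?J \<subseteq> carrier R" using assms by auto
      show "?J \<noteq> {}" by blast
      fix u assume "u \<in> ?J"
      then obtain x y where u: "u = x \<otimes> a \<oplus> y \<otimes> b" "x \<in> carrier R" "y \<in> carrier R" by blast
      hence "\<ominus> u = (\<ominus> x) \<otimes> a \<oplus> (\<ominus> y) \<otimes> b"
        using assms by (simp add: l_minus minus_add)
      thus "\<ominus> u \<in> ?J" using u by blast
      fix v assume "v \<in> ?J"
      then obtain x' y' where v: "v = x' \<otimes> a \<oplus> y' \<otimes> b" "x' \<in> carrier R" "y' \<in> carrier R" by blast
      hence "u \<oplus> v = (x \<oplus> x') \<otimes> a \<oplus> (y \<oplus> y') \<otimes> b"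
        using assms u by (simp add: l_distr a_ac)
      thus "u \<oplus> v \<in> ?J" using u v by blast
    qed
    fix u r assume ur: "u \<in> ?J" "r \<in> carrier R"
    then obtain x y where u: "u = x \<otimes> a \<oplus> y \<otimes> b" "x \<in> carrier R" "y \<in> carrier R" by blast
    hence "r \<otimes> u = (r \<otimes> x) \<otimes> a \<oplus> (r \<otimes> y) \<otimes> b"
      using assms ur by (simp add: r_distr m_assoc)
    thus "r \<otimes> u \<in> ?J" using u ur by blast
    moreover have "u \<otimes> r = r \<otimes> u" using u ur assms by (simp add: m_comm)
    ultimately show "u \<otimes> r \<in> ?J" by simp
  qed
  have "a = \<one> \<otimes> a \<oplus> \<zero> \<otimes> b" "b = \<zero> \<otimes> a \<oplus> \<one> \<otimes> b" using assms by simp_all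
  hence "{a, b} \<subseteq> ?J" by blast
  thus "Idl {a, b} \<subseteq> ?J" using J by (rule genideal_minimal[rotated])
  interpret I: ideal "Idl {a, b}" R using assms by (intro genideal_ideal) auto
  have "a \<in> Idl {a, b}" "b \<in> Idl {a, b}" using genideal_self[of "{a, b}"] assms by auto
  thus "?J \<subseteq> Idl {a, b}" using I.I_l_closed by auto
qed

section \<open>Syzygies of a pair of elements\<close>

definition syzygies :: "('a, 'x) ring_scheme \<Rightarrow> 'a \<Rightarrow> 'a \<Rightarrow> (nat \<Rightarrow> 'a) set"
  where "syzygies R a b =
    {x \<in> carrier (free_module R 2). x 0 \<otimes>\<^bsub>R\<^esub> a \<oplus>\<^bsub>R\<^esub> x 1 \<otimes>\<^bsub>R\<^esub> b = \<zero>\<^bsub>R\<^esub>}"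

text \<open>Restricting to \<open>{..<2}\<close> makes the function \<open>undefined\<close>
  elsewhere, as membership in the extensional function space of \<open>free_module R 2\<close>
  demands.\<close>

definition vec2 :: "'a \<Rightarrow> 'a \<Rightarrow> nat \<Rightarrow> 'a"
  where "vec2 x y = (\<lambda>i\<in>{..<2}. if i = 0 then x else y)"

lemma vec2_nth: "vec2 x y 0 = x" "vec2 x y 1 = y"
  by (simp_all add: vec2_def)

lemma vec2_closed: "x \<in> carrier R \<Longrightarrow> y \<in> carrier R \<Longrightarrow> vec2 x y \<in> carrier (free_module R 2)"
  by (auto simp: vec2_def free_module_simps)

lemma free_module_2_eqI:
  assumes "x \<in> carrier (free_module R 2)" "y \<in> carrier (free_module R 2)" "x 0 = y 0" "x 1 = y 1"
  shows "x = y"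
  using assms by (intro free_module_eqI[OF assms(1,2)]) (auto simp: less_2_cases_iff)

lemma (in cring) syzygies_submodule:
  assumes "a \<in> carrier R" "b \<in> carrier R"
  shows "submodule (syzygies R a b) R (free_module R 2)"
proof -
  interpret F: module R "free_module R 2" by (rule free_module_module)
  note nth = free_module_nth_closed[where R = R and n = 2]
  show ?thesis
  proof (rule F.submoduleI_smult)
    fix x y assume xy: "x \<in> syzygies R a b" "y \<in> syzygies R a b"
    hence c: "x 0 \<in> carrier R" "x 1 \<in> carrier R" "y 0 \<in> carrier R" "y 1 \<in> carrier R"
      using nth by (auto simp: syzygies_def)
    have "(x 0 \<oplus> y 0) \<otimes> a \<oplus> (x 1 \<oplus> y 1) \<otimes> b = (x 0 \<otimes> a \<oplus> x 1 \<otimes> b) \<oplus> (y 0 \<otimes> a \<oplus> y 1 \<otimes> b)"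
      using c assms by (simp add: l_distr a_ac)
    thus "x \<oplus>\<^bsub>free_module R 2\<^esub> y \<in> syzygies R a b"
      using xy by (simp add: syzygies_def free_module_nth)
  next
    fix r x assume rx: "r \<in> carrier R" "x \<in> syzygies R a b"
    hence c: "x 0 \<in> carrier R" "x 1 \<in> carrier R"
      using nth by (auto simp: syzygies_def)
    have "(r \<otimes> x 0) \<otimes> a \<oplus> (r \<otimes> x 1) \<otimes> b = r \<otimes> (x 0 \<otimes> a \<oplus> x 1 \<otimes> b)"
      using c assms rx by (simp add: r_distr m_assoc)
    thus "r \<odot>\<^bsub>free_module R 2\<^esub> x \<in> syzygies R a b"
      using rx by (simp add: syzygies_def free_module_nth)
  qed (use assms in \<open>auto simp: syzygies_def free_module_nth\<close>)
qed

text \<open>The syzygies are the kernel of the map from the free module of rank 2 onto the ideal.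
  From right to left this map is itself a presentation; from left to right only some presentation is
  given, and \<open>finitely_presented_kernel\<close> passes from it to this one.\<close>

lemma finitely_presented_pair_ideal_iff:
  fixes R :: "('a, 'x) ring_scheme" (structure)
  assumes "cring R" "a \<in> carrier R" "b \<in> carrier R"
  shows "finitely_presented_module R (as_module R (Idl {a, b})) \<longleftrightarrow>
    finitely_generated_submodule R (free_module R 2) (syzygies R a b)"
proof -
  interpret cring R by fact
  let ?I = "Idl {a, b}" and ?g = "\<lambda>x :: nat \<Rightarrow> 'a. x 0 \<otimes> a \<oplus> x 1 \<otimes> b"
  note I = genideal_pair[OF assms(2,3)]
  note nth = free_module_nth_closed[where R = R and n = 2]
  have M: "module R (as_module R ?I)"
    using assms by (intro as_module_ideal genideal_ideal) auto
  have g: "?g \<in> mod_hom R (free_module R 2) (as_module R ?I)"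
    unfolding mod_hom_def
  proof (intro CollectI conjI ballI Pi_I)
    fix x assume x: "x \<in> carrier (free_module R 2)"
    have xc: "x 0 \<in> carrier R" "x 1 \<in> carrier R" using nth[OF x] by simp_all
    thus "?g x \<in> carrier (as_module R ?I)" unfolding as_module_simps I by blast
    { fix y assume y: "y \<in> carrier (free_module R 2)"
      have "y 0 \<in> carrier R" "y 1 \<in> carrier R" using nth[OF y] by simp_all
      with xc show "?g (x \<oplus>\<^bsub>free_module R 2\<^esub> y) = ?g x \<oplus>\<^bsub>as_module R ?I\<^esub> ?g y"
        using assms(2,3) by (simp add: as_module_simps free_module_nth l_distr a_ac) }
    fix r assume "r \<in> carrier R"
    with xc show "?g (r \<odot>\<^bsub>free_module R 2\<^esub> x) = r \<odot>\<^bsub>as_module R ?I\<^esub> ?g x"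
      using assms(2,3) by (simp add: as_module_simps free_module_nth r_distr m_assoc)
  qed
  have im: "?g ` carrier (free_module R 2) = carrier (as_module R ?I)"
  proof
    show "carrier (as_module R ?I) \<subseteq> ?g ` carrier (free_module R 2)"
    proof
      fix z assume "z \<in> carrier (as_module R ?I)"
      then obtain x y where "z = x \<otimes> a \<oplus> y \<otimes> b" "x \<in> carrier R" "y \<in> carrier R"
        by (auto simp: as_module_simps I)
      thus "z \<in> ?g ` carrier (free_module R 2)"
        by (intro image_eqI[of _ _ "vec2 x y"]) (simp_all only: vec2_nth vec2_closed)
    qed
  qed (use mod_homD(1)[OF g] in blast)
  have k: "a_kernel (free_module R 2) (as_module R ?I) ?g = syzygies R a b"
    unfolding a_kernel_eq syzygies_def as_module_simps ..
  show ?thesis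
  proof
    assume "finitely_presented_module R (as_module R ?I)"
    from finitely_presented_kernel[OF this g im]
    show "finitely_generated_submodule R (free_module R 2) (syzygies R a b)" unfolding k .
  next
    assume "finitely_generated_submodule R (free_module R 2) (syzygies R a b)"
    hence "finitely_generated_submodule R (free_module R 2)
        (a_kernel (free_module R 2) (as_module R ?I) ?g)" unfolding k .
    with M g im show "finitely_presented_module R (as_module R ?I)"
      unfolding finitely_presented_module_def by blast
  qed
qed

section \<open>Descent of finite generation along a surjection of rings\<close>

lemma (in cring) free_module_uminus_nth:
  assumes "x \<in> carrier (free_module R n)" "i < n"
  shows "(\<ominus>\<^bsub>free_module R n\<^esub> x) i = \<ominus> (x i)"
proof -
  interpret F: module R "free_module R n" by (rule free_module_module)
  have "(\<ominus>\<^bsub>free_module R n\<^esub> x) i \<oplus> x i = \<zero>"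
    using F.M.l_neg[OF assms(1)] free_module_nth(1,2)[OF assms(2)] by metis
  thus ?thesis
    using minus_equality free_module_nth_closed[OF _ assms(2)] F.M.a_inv_closed assms(1) by metis
qed

lemma (in cring) free_module_minus_nth:
  assumes "x \<in> carrier (free_module R n)" "y \<in> carrier (free_module R n)" "i < n"
  shows "(x \<ominus>\<^bsub>free_module R n\<^esub> y) i = x i \<ominus> y i"
  using assms by (simp add: a_minus_def free_module_nth free_module_uminus_nth)

text \<open>Let \<open>J\<close> be the kernel of \<open>\<pi>\<close>. As every element of
  \<open>J\<close> is a combination of \<open>a\<close> and \<open>b\<close> with coefficients in
  \<open>J\<close>, syzygies over \<open>R\<close> map onto those over \<open>A\<close>. Those that
  map to zero have entries in \<open>J\<close>, hence are multiples of \<open>k\<close>. So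
  \<open>k\<close> and lifts of finitely many generators over \<open>A\<close> generate.\<close>

lemma syzygies_descent:
  fixes R :: "('a, 'x) ring_scheme" (structure) and A :: "('b, 'y) ring_scheme"
  assumes "ring_hom_cring R A \<pi>" and surj: "\<pi> ` carrier R = carrier A"
    and a: "a \<in> carrier R" and b: "b \<in> carrier R"
    and C: "\<And>c. c \<in> a_kernel R A \<pi> \<Longrightarrow>
      \<exists>p\<in>a_kernel R A \<pi>. \<exists>q\<in>a_kernel R A \<pi>. c = p \<otimes> a \<oplus> q \<otimes> b"
    and k: "k \<in> syzygies R a b"
      "\<And>x. x \<in> syzygies R a b \<Longrightarrow> x 0 \<in> a_kernel R A \<pi> \<Longrightarrow> x 1 \<in> a_kernel R A \<pi> \<Longrightarrow>
        \<exists>r\<in>carrier R. x = r \<odot>\<^bsub>free_module R 2\<^esub> k"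
    and fg: "finitely_generated_submodule A (free_module A 2) (syzygies A (\<pi> a) (\<pi> b))"
  shows "finitely_generated_submodule R (free_module R 2) (syzygies R a b)"
proof -
  interpret h: ring_hom_cring R A \<pi> by fact
  interpret F: module R "free_module R 2" by (rule h.R.free_module_module)
  interpret G: module A "free_module A 2" by (rule h.S.free_module_module)
  let ?F = "free_module R 2" and ?G = "free_module A 2"
  let ?N = "syzygies R a b" and ?L = "syzygies A (\<pi> a) (\<pi> b)"
  define P where "P = (\<lambda>x :: nat \<Rightarrow> 'a. \<lambda>i\<in>{..<2::nat}. \<pi> (x i))"
  note nth = free_module_nth_closed[where R = R and n = 2]
  have P_nth: "P x i = \<pi> (x i)" if "i < 2" for x i using that by (simp add: P_def)
  have P_closed: "P x \<in> carrier ?G" if "x \<in> carrier ?F" for x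
    using nth[OF that] by (simp add: P_def free_module_simps)
  have P_add: "P (x \<oplus>\<^bsub>?F\<^esub> y) = P x \<oplus>\<^bsub>?G\<^esub> P y" if "x \<in> carrier ?F" "y \<in> carrier ?F" for x y
    using that nth by (intro free_module_eqI[where R = A and n = 2])
      (simp_all add: P_closed P_nth free_module_nth)
  have P_smult: "P (r \<odot>\<^bsub>?F\<^esub> x) = \<pi> r \<odot>\<^bsub>?G\<^esub> P x" if "r \<in> carrier R" "x \<in> carrier ?F" for r x
    using that nth by (intro free_module_eqI[where R = A and n = 2])
      (simp_all add: P_closed P_nth free_module_nth)
  have NF: "?N \<subseteq> carrier ?F" by (auto simp: syzygies_def)
  have Nsub: "submodule ?N R ?F" by (rule h.R.syzygies_submodule[OF a b])
  have Lsub: "submodule ?L A ?G" using a b by (intro h.S.syzygies_submodule) auto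
  have PN: "P ` ?N = ?L"
  proof
    show "P ` ?N \<subseteq> ?L"
    proof
      fix y assume "y \<in> P ` ?N"
      then obtain x where x: "y = P x" "x \<in> ?N" by blast
      have c: "x 0 \<in> carrier R" "x 1 \<in> carrier R" using x(2) nth by (auto simp: syzygies_def)
      have "\<pi> (x 0) \<otimes>\<^bsub>A\<^esub> \<pi> a \<oplus>\<^bsub>A\<^esub> \<pi> (x 1) \<otimes>\<^bsub>A\<^esub> \<pi> b = \<pi> (x 0 \<otimes> a \<oplus> x 1 \<otimes> b)"
        using c a b by simp
      also have "\<dots> = \<zero>\<^bsub>A\<^esub>" using x(2) by (simp add: syzygies_def)
      finally show "y \<in> ?L" using x NF P_closed by (auto simp: syzygies_def P_nth)
    qed
    show "?L \<subseteq> P ` ?N"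
    proof
      fix y assume y: "y \<in> ?L"
      hence yc: "y \<in> carrier ?G" by (simp add: syzygies_def)
      hence "y 0 \<in> \<pi> ` carrier R" "y 1 \<in> \<pi> ` carrier R"
        unfolding surj by (auto intro: free_module_nth_closed)
      then obtain r r' where r: "r \<in> carrier R" "r' \<in> carrier R" "y 0 = \<pi> r" "y 1 = \<pi> r'"
        by blast
      \<comment> \<open>An arbitrary lift of \<open>y\<close> misses being a syzygy by an element of
        the kernel. Writing this error as a combination of \<open>a\<close> and \<open>b\<close>
        with coefficients in the kernel, and subtracting the coefficients, gives a syzygy with the
        same image.\<close>
      have "r \<otimes> a \<oplus> r' \<otimes> b \<in> a_kernel R A \<pi>"
      proof -
        have "\<pi> (r \<otimes> a \<oplus> r' \<otimes> b) = y 0 \<otimes>\<^bsub>A\<^esub> \<pi> a \<oplus>\<^bsub>A\<^esub> y 1 \<otimes>\<^bsub>A\<^esub> \<pi> b"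
          unfolding r(3,4) using r(1,2) a b by simp
        also have "\<dots> = \<zero>\<^bsub>A\<^esub>" using y unfolding syzygies_def by blast
        finally have "\<pi> (r \<otimes> a \<oplus> r' \<otimes> b) = \<zero>\<^bsub>A\<^esub>" .
        moreover have "r \<otimes> a \<oplus> r' \<otimes> b \<in> carrier R" using r(1,2) a b by simp
        ultimately show ?thesis unfolding a_kernel_eq by blast
      qed
      then obtain p q where pq: "p \<in> a_kernel R A \<pi>" "q \<in> a_kernel R A \<pi>"
        "r \<otimes> a \<oplus> r' \<otimes> b = p \<otimes> a \<oplus> q \<otimes> b" using C by blast
      have pqc: "p \<in> carrier R" "q \<in> carrier R" "\<pi> p = \<zero>\<^bsub>A\<^esub>" "\<pi> q = \<zero>\<^bsub>A\<^esub>"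
        using pq(1,2) unfolding a_kernel_eq by blast+
      let ?x = "vec2 (r \<ominus> p) (r' \<ominus> q)"
      have xc: "?x \<in> carrier ?F" using r pqc by (intro vec2_closed) auto
      have "(r \<ominus> p) \<otimes> a \<oplus> (r' \<ominus> q) \<otimes> b = (r \<otimes> a \<oplus> r' \<otimes> b) \<ominus> (p \<otimes> a \<oplus> q \<otimes> b)"
        using r(1,2) pqc(1,2) a b by (simp add: a_minus_def h.R.l_distr h.R.l_minus h.R.minus_add h.R.a_ac)
      also have "\<dots> = \<zero>" unfolding pq(3) using pqc(1,2) a b by (simp add: a_minus_def h.R.r_neg)
      finally have "?x \<in> ?N" using xc unfolding syzygies_def mem_Collect_eq vec2_nth by blast
      moreover have "P ?x = y"
      proof (rule free_module_2_eqI[OF P_closed[OF xc] yc])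
        show "P ?x 0 = y 0" using P_nth[of 0 ?x] r(1,3) pqc unfolding vec2_nth by (simp add: a_minus_def)
        show "P ?x 1 = y 1" using P_nth[of 1 ?x] r(2,4) pqc
          unfolding vec2_nth by (simp add: a_minus_def)
      qed
      ultimately show "y \<in> P ` ?N" by blast
    qed
  qed
  obtain S' where S': "S' \<subseteq> ?L" "finite S'" "\<And>H. submodule H A ?G \<Longrightarrow> S' \<subseteq> H \<Longrightarrow> ?L \<subseteq> H"
    using fg unfolding finitely_generated_submodule_iff[OF G.module_axioms Lsub] by blast
  obtain S where S: "S \<subseteq> ?N" "finite S" "S' = P ` S"
    using finite_subset_image[OF S'(2)] S'(1) unfolding PN[symmetric] by meson
  show ?thesis unfolding finitely_generated_submodule_iff[OF F.module_axioms Nsub]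
  proof (intro exI[of _ "insert k S"] conjI allI impI subsetI)
    show "x \<in> ?N" if "x \<in> insert k S" for x using that S(1) k(1) by blast
    show "finite (insert k S)" using S(2) by blast
  next
    fix H x assume H: "submodule H R ?F" "insert k S \<subseteq> H" and x: "x \<in> ?N"
    note HE = F.submoduleE[OF H(1)] and NE = F.submoduleE[OF Nsub]
    \<comment> \<open>Scalars of \<open>A\<close> lift to \<open>R\<close>, so the image is closed
      under them. It contains \<open>S'\<close>, hence all of \<open>?L\<close>. Intersecting with
      \<open>?N\<close> ensures that the \<open>x'\<close> obtained below is a syzygy, and with it
      the difference \<open>x - x'\<close>.\<close>
    have "submodule (P ` (H \<inter> ?N)) A ?G"
    proof (rule G.submoduleI_smult)
      have "P \<zero>\<^bsub>?F\<^esub> = \<zero>\<^bsub>?G\<^esub>"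
        by (intro free_module_eqI[where R = A and n = 2])
          (simp_all add: P_closed P_nth free_module_nth)
      thus "\<zero>\<^bsub>?G\<^esub> \<in> P ` (H \<inter> ?N)"
        using F.submodule_zero[OF H(1)] F.submodule_zero[OF Nsub] by (metis IntI image_eqI)
    next
      fix u v assume "u \<in> P ` (H \<inter> ?N)" "v \<in> P ` (H \<inter> ?N)"
      then obtain x y where xy: "u = P x" "v = P y" "x \<in> H" "x \<in> ?N" "y \<in> H" "y \<in> ?N" by blast
      hence "u \<oplus>\<^bsub>?G\<^esub> v = P (x \<oplus>\<^bsub>?F\<^esub> y)" using P_add[of x y] subsetD[OF NF] by simp
      thus "u \<oplus>\<^bsub>?G\<^esub> v \<in> P ` (H \<inter> ?N)" using xy HE(5) NE(5) by blast
    next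
      fix c u assume "c \<in> carrier A" "u \<in> P ` (H \<inter> ?N)"
      then obtain r x where rx: "c = \<pi> r" "r \<in> carrier R" "u = P x" "x \<in> H" "x \<in> ?N"
        unfolding surj[symmetric] by blast
      hence "c \<odot>\<^bsub>?G\<^esub> u = P (r \<odot>\<^bsub>?F\<^esub> x)" using P_smult[of r x] subsetD[OF NF] by simp
      thus "c \<odot>\<^bsub>?G\<^esub> u \<in> P ` (H \<inter> ?N)" using rx HE(4) NE(4) by blast
    qed (use P_closed NF in auto)
    moreover have "S' \<subseteq> P ` (H \<inter> ?N)" using S(1,3) H(2) by blast
    ultimately have "P x \<in> P ` (H \<inter> ?N)" using S'(3) x PN by blast
    then obtain x' where x': "P x = P x'" "x' \<in> H" "x' \<in> ?N" by blast
    have xF: "x \<in> carrier ?F" "x' \<in> carrier ?F" using x x' NF by auto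
    \<comment> \<open>\<open>x\<close> and \<open>x'\<close> have the same image over
      \<open>A\<close>, so the entries of \<open>?d\<close> lie in the kernel and \<open>?d\<close>
      is a multiple of \<open>k\<close>.\<close>
    let ?d = "x \<ominus>\<^bsub>?F\<^esub> x'"
    have "?d i \<in> a_kernel R A \<pi>" if "i < 2" for i
    proof -
      have eq: "\<pi> (x i) = \<pi> (x' i)" using x'(1) P_nth[OF that] by metis
      note c = nth[OF xF(1) that] nth[OF xF(2) that]
      have "\<pi> (x i \<ominus> x' i) = \<zero>\<^bsub>A\<^esub>"
        unfolding a_minus_def using c by (simp add: eq h.S.r_neg)
      thus ?thesis unfolding a_kernel_eq h.R.free_module_minus_nth[OF xF that] using c by blast
    qed
    moreover have "?d \<in> ?N" by (rule F.submodule_minus[OF Nsub x x'(3)])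
    ultimately obtain r where "r \<in> carrier R" "?d = r \<odot>\<^bsub>?F\<^esub> k"
      using k(2)[of ?d] by auto
    hence "?d \<in> H" using HE(4) H(2) by auto
    hence "?d \<oplus>\<^bsub>?F\<^esub> x' \<in> H" using HE(5) x'(2) by blast
    moreover have "?d \<oplus>\<^bsub>?F\<^esub> x' = x"
      using xF by (simp add: a_minus_def F.M.a_assoc F.M.l_neg)
    ultimately show "x \<in> H" by simp
  qed
qed


section \<open>Syzygies under scaling and of unimodular pairs\<close>

lemma (in cring) syzygies_scale:
  assumes "a \<in> carrier R" "b \<in> carrier R" "non_zero_divisor R u"
  shows "syzygies R (a \<otimes> u) (b \<otimes> u) = syzygies R a b"
proof -
  have u: "u \<in> carrier R" and nzd: "\<And>x. x \<in> carrier R \<Longrightarrow> u \<otimes> x = \<zero> \<Longrightarrow> x = \<zero>"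
    using assms(3) by (auto simp: non_zero_divisor_def)
  have "x 0 \<otimes> (a \<otimes> u) \<oplus> x 1 \<otimes> (b \<otimes> u) = \<zero> \<longleftrightarrow> x 0 \<otimes> a \<oplus> x 1 \<otimes> b = \<zero>"
    if x: "x \<in> carrier (free_module R 2)" for x
  proof -
    have c: "x 0 \<in> carrier R" "x 1 \<in> carrier R"
      using free_module_nth_closed[OF x] by simp_all
    have "x 0 \<otimes> (a \<otimes> u) \<oplus> x 1 \<otimes> (b \<otimes> u) = u \<otimes> (x 0 \<otimes> a \<oplus> x 1 \<otimes> b)"
      using c u assms(1,2) by (simp add: r_distr m_ac)
    thus ?thesis using nzd[of "x 0 \<otimes> a \<oplus> x 1 \<otimes> b"] c u assms(1,2) by auto
  qed
  thus ?thesis unfolding syzygies_def by blast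
qed

text \<open>Replacing \<open>x 1 \<otimes> b\<close> by \<open>\<ominus> (x 0 \<otimes> a)\<close>
  turns the factor times \<open>b\<close> into
  \<open>x 0 \<otimes> (s \<otimes> a \<oplus> t \<otimes> b)\<close>, which is \<open>x 0\<close>;
  the other entry is similar. The factor is kept explicit because it lies in every ideal that
  contains both entries of \<open>x\<close>.\<close>

lemma (in cring) syzygies_unimodular:
  assumes "a \<in> carrier R" "b \<in> carrier R" "s \<in> carrier R" "t \<in> carrier R"
    and "s \<otimes> a \<oplus> t \<otimes> b = \<one>" and x: "x \<in> syzygies R a b"
  shows "x = (t \<otimes> x 0 \<ominus> s \<otimes> x 1) \<odot>\<^bsub>free_module R 2\<^esub> vec2 b (\<ominus> a)"
proof -
  let ?w = "t \<otimes> x 0 \<ominus> s \<otimes> x 1"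
  have xc: "x \<in> carrier (free_module R 2)" using x by (simp add: syzygies_def)
  have c: "x 0 \<in> carrier R" "x 1 \<in> carrier R"
    using free_module_nth_closed[OF xc] by simp_all
  have eq: "x 0 \<otimes> a \<oplus> x 1 \<otimes> b = \<zero>" using x unfolding syzygies_def by blast
  have e0: "\<ominus> (x 1 \<otimes> b) = x 0 \<otimes> a" using minus_equality[OF eq] c assms(1,2) by simp
  have e1: "\<ominus> (x 0 \<otimes> a) = x 1 \<otimes> b" unfolding e0[symmetric] using c assms(1,2) by simp
  have "?w \<otimes> b = t \<otimes> x 0 \<otimes> b \<oplus> s \<otimes> (\<ominus> (x 1 \<otimes> b))"
    using c assms(1-4) by (simp add: a_minus_def l_distr l_minus r_minus m_assoc)
  also have "\<dots> = x 0 \<otimes> (s \<otimes> a \<oplus> t \<otimes> b)"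
    unfolding e0 using c assms(1-4) by (simp add: r_distr m_ac a_ac)
  finally have w0: "?w \<otimes> b = x 0" unfolding assms(5) using c by simp
  have "?w \<otimes> (\<ominus> a) = t \<otimes> (\<ominus> (x 0 \<otimes> a)) \<oplus> s \<otimes> x 1 \<otimes> a"
    using c assms(1-4) by (simp add: a_minus_def l_distr l_minus r_minus m_assoc minus_add)
  also have "\<dots> = x 1 \<otimes> (s \<otimes> a \<oplus> t \<otimes> b)"
    unfolding e1 using c assms(1-4) by (simp add: r_distr m_ac a_ac)
  finally have w1: "?w \<otimes> (\<ominus> a) = x 1" unfolding assms(5) using c by simp
  have wc: "?w \<in> carrier R" and kc: "vec2 b (\<ominus> a) \<in> carrier (free_module R 2)"
    using c assms by (auto intro: vec2_closed)
  have one_less_2: "1 < (2::nat)" by simp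
  show ?thesis
  proof (rule free_module_2_eqI[OF xc free_module_closed(3)[OF wc kc]])
    show "x 0 = (?w \<odot>\<^bsub>free_module R 2\<^esub> vec2 b (\<ominus> a)) 0"
      using w0 unfolding free_module_nth(3)[OF zero_less_numeral] vec2_nth by simp
    show "x 1 = (?w \<odot>\<^bsub>free_module R 2\<^esub> vec2 b (\<ominus> a)) 1"
      using w1 unfolding free_module_nth(3)[OF one_less_2] vec2_nth by simp
  qed
qed

text \<open>This is the Koszul relation \<open>b a - a b = 0\<close>; it generates all syzygies once
  \<open>a\<close> and \<open>b\<close> generate the unit ideal.\<close>

lemma (in cring) syzygies_unimodular_generator:
  assumes "a \<in> carrier R" "b \<in> carrier R"
  shows "vec2 b (\<ominus> a) \<in> syzygies R a b"
proof -
  have "b \<otimes> a \<oplus> (\<ominus> a) \<otimes> b = \<zero>" using assms by (simp add: l_minus m_comm[of a b] r_neg)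
  thus ?thesis using assms unfolding syzygies_def mem_Collect_eq vec2_nth
    by (auto intro: vec2_closed)
qed

text \<open>The zero pair is treated apart, since the isomorphism hypothesis concerns non-zero
  ideals only. Every vector is a syzygy here, and the unit vectors generate.\<close>

lemma syzygies_zero_fg:
  assumes "cring R"
  shows "finitely_generated_submodule R (free_module R 2) (syzygies R \<zero>\<^bsub>R\<^esub> \<zero>\<^bsub>R\<^esub>)"
proof -
  interpret cring R by fact
  interpret F: module R "free_module R 2" by (rule free_module_module)
  have "syzygies R \<zero>\<^bsub>R\<^esub> \<zero>\<^bsub>R\<^esub> = carrier (free_module R 2)"
    using free_module_nth_closed[where R = R and n = 2] by (auto simp: syzygies_def)
  moreover have "finitely_generated_submodule R (free_module R 2) (carrier (free_module R 2))"
    unfolding finitely_generated_submodule_iff[OF F.module_axioms F.carrier_is_submodule]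
  proof (intro exI[of _ "unit_vec R 2 ` {..<2}"] conjI allI impI)
    fix H assume "submodule H R (free_module R 2)" "unit_vec R 2 ` {..<2} \<subseteq> H"
    thus "carrier (free_module R 2) \<subseteq> H" using submodule_unit_vec by blast
  qed (auto simp: unit_vec_closed)
  ultimately show ?thesis by simp
qed

lemma syzygies_unimodular_fg:
  fixes R :: "('a, 'x) ring_scheme" (structure)
  assumes "cring R" "a \<in> carrier R" "b \<in> carrier R" "s \<in> carrier R" "t \<in> carrier R"
    and "s \<otimes> a \<oplus> t \<otimes> b = \<one>"
  shows "finitely_generated_submodule R (free_module R 2) (syzygies R a b)"
proof -
  interpret cring R by fact
  interpret F: module R "free_module R 2" by (rule free_module_module)
  let ?k = "vec2 b (\<ominus> a)"
  show ?thesis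
    unfolding finitely_generated_submodule_iff[OF F.module_axioms syzygies_submodule[OF assms(2,3)]]
  proof (intro exI[of _ "{?k}"] conjI allI impI subsetI)
    fix H x assume H: "submodule H R (free_module R 2)" "{?k} \<subseteq> H" and x: "x \<in> syzygies R a b"
    have xc: "x \<in> carrier (free_module R 2)" using x by (simp add: syzygies_def)
    have "t \<otimes> x 0 \<ominus> s \<otimes> x 1 \<in> carrier R"
      using free_module_nth_closed[OF xc] assms(4,5) by simp
    hence "(t \<otimes> x 0 \<ominus> s \<otimes> x 1) \<odot>\<^bsub>free_module R 2\<^esub> ?k \<in> H"
      using F.submoduleE(4)[OF H(1)] H(2) by blast
    thus "x \<in> H" using syzygies_unimodular[OF assms(2-6) x] by simp
  qed (use syzygies_unimodular_generator[OF assms(2,3)] in auto)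
qed

section \<open>The conductor square\<close>

text \<open>
  An isomorphism \<open>h : I' \<rightarrow> I\<close> satisfies \<open>h i * j = i * h j\<close>, so evaluating at a relation
  \<open>s * a' + t * b' = 1\<close> over \<open>T\<close> shows that \<open>h\<close> is multiplication by \<open>u = s * a + t * b\<close>.
\<close>

lemma isomorphic_ideal_scaling:
  fixes T :: "('a, 'x) ring_scheme" (structure)
  defines "R \<equiv> \<lambda>K. T\<lparr>carrier := K\<rparr>"
  assumes "cring T" "subring K T" and C: "ideal C (R K)" "ideal C T" "c \<in> C" "non_zero_divisor T c"
    and ab: "a \<in> K" "b \<in> K"
    and I': "ideal I' (R K)"
      "module_isomorphic (R K) (as_module (R K) I') (as_module (R K) (Idl\<^bsub>R K\<^esub> {a, b}))"
      "Idl I' = carrier T"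
  obtains a' b' s t u where "a' \<in> K" "b' \<in> K" "s \<in> carrier T" "t \<in> carrier T"
    "s \<otimes> a' \<oplus> t \<otimes> b' = \<one>" "non_zero_divisor T u" "a = a' \<otimes> u" "b = b' \<otimes> u"
proof -
  interpret T: cring T by fact
  have Rs: "carrier (R K) = K" "monoid.mult (R K) = monoid.mult T" "ring.add (R K) = ring.add T"
    "one (R K) = one T" "ring.zero (R K) = ring.zero T"
    by (simp_all add: R_def)
  have KT: "K \<subseteq> carrier T" using T.subcringI'[OF assms(3)] subcringE(1) by blast
  interpret R: cring "R K"
    unfolding R_def using T.subcring_iff[OF KT] T.subcringI'[OF assms(3)] by blast
  have abR: "a \<in> carrier (R K)" "b \<in> carrier (R K)" using ab by (simp_all add: Rs)
  note I = R.genideal_pair[OF abR, unfolded Rs]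
  have I'K: "I' \<subseteq> K" using ideal.Icarr[OF I'(1)] by (auto simp: Rs)
  interpret I': ideal I' "R K" by fact
  interpret CT: ideal C T by fact
  obtain h where h: "h \<in> mod_hom (R K) (as_module (R K) I') (as_module (R K) (Idl\<^bsub>R K\<^esub> {a, b}))"
    "bij_betw h I' (Idl\<^bsub>R K\<^esub> {a, b})"
    using I'(2) unfolding module_isomorphic_def as_module_simps by blast
  have h_add: "h (x \<oplus> y) = h x \<oplus> h y" if "x \<in> I'" "y \<in> I'" for x y
    using mod_homD(2)[OF h(1)] that unfolding as_module_simps Rs by blast
  have h_mult: "h (r \<otimes> x) = r \<otimes> h x" if "r \<in> K" "x \<in> I'" for r x
    using mod_homD(3)[OF h(1)] that unfolding as_module_simps Rs by blast
  have h_closed: "h x \<in> carrier T" if "x \<in> I'" for x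
  proof -
    have "h x \<in> Idl\<^bsub>R K\<^esub> {a, b}" using mod_homD(1)[OF h(1)] that unfolding as_module_simps .
    then obtain y z where "h x = y \<otimes> a \<oplus> z \<otimes> b" "y \<in> K" "z \<in> K" unfolding I by blast
    moreover have "a \<in> carrier T" "b \<in> carrier T" "y \<in> carrier T" "z \<in> carrier T"
      using calculation ab KT by blast+
    ultimately show ?thesis by simp
  qed
  have I'_mult: "r \<otimes> x \<in> I'" if "r \<in> K" "x \<in> I'" for r x
    using I'.I_l_closed that by (simp add: Rs)
  have I'_add: "x \<oplus> y \<in> I'" if "x \<in> I'" "y \<in> I'" for x y
    using I'.a_closed that by (simp add: Rs)
  have "a \<in> Idl\<^bsub>R K\<^esub> {a, b}" "b \<in> Idl\<^bsub>R K\<^esub> {a, b}"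
    using R.genideal_self[of "{a, b}"] abR by auto
  then obtain a' b' where a': "a' \<in> I'" "h a' = a" and b': "b' \<in> I'" "h b' = b"
    using h(2) unfolding bij_betw_def by (metis imageE)
  have cT: "a' \<in> carrier T" "b' \<in> carrier T" using a' b' I'K KT by auto
  \<comment> \<open>By injectivity of \<open>h\<close>, a combination of \<open>a\<close> and
    \<open>b\<close> that equals \<open>h i\<close> gives the same combination of \<open>a'\<close>
    and \<open>b'\<close> for \<open>i\<close>. So the ideal of \<open>T\<close> generated by
    \<open>I'\<close>, which is all of \<open>T\<close>, is generated by \<open>a'\<close> and
    \<open>b'\<close>.\<close>
  have "i \<in> Idl {a', b'}" if i: "i \<in> I'" for i
  proof -
    have "h i \<in> Idl\<^bsub>R K\<^esub> {a, b}" using h(2) i by (auto simp: bij_betw_def)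
    then obtain x y where xy: "h i = x \<otimes> a \<oplus> y \<otimes> b" "x \<in> K" "y \<in> K" unfolding I by blast
    have "h (x \<otimes> a' \<oplus> y \<otimes> b') = h i"
      using xy a' b' by (simp add: h_add h_mult I'_mult)
    moreover have "x \<otimes> a' \<oplus> y \<otimes> b' \<in> I'"
      by (intro I'_add I'_mult xy(2,3) a'(1) b'(1))
    ultimately have "i = x \<otimes> a' \<oplus> y \<otimes> b'"
      using h(2) i unfolding bij_betw_def inj_on_def by metis
    thus ?thesis unfolding T.genideal_pair[OF cT]
      using subsetD[OF KT xy(2)] subsetD[OF KT xy(3)] by (intro CollectI exI conjI)
  qed
  hence "Idl I' \<subseteq> Idl {a', b'}" using cT
    by (intro T.genideal_minimal T.genideal_ideal) auto
  hence "\<one> \<in> Idl {a', b'}" using I'(3) by auto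
  then obtain s t where st: "s \<in> carrier T" "t \<in> carrier T" "s \<otimes> a' \<oplus> t \<otimes> b' = \<one>"
    unfolding T.genideal_pair[OF cT] by auto
  \<comment> \<open>\<open>u\<close> is the value at \<open>\<one>\<close> that a
    \<open>T\<close>-linear extension of \<open>h\<close> would have to take.\<close>
  define u where "u = s \<otimes> a \<oplus> t \<otimes> b"
  have abT: "a \<in> carrier T" "b \<in> carrier T" using ab KT by auto
  have u: "u \<in> carrier T" using abT st by (simp add: u_def)
  have hu: "h i = i \<otimes> u" if i: "i \<in> I'" for i
  proof -
    have iT: "i \<in> carrier T" "i \<in> K" using i I'K KT by auto
    \<comment> \<open>Both sides equal \<open>h (i \<otimes> j)\<close>.\<close>
    have sw: "i \<otimes> h j = h i \<otimes> j" if j: "j \<in> I'" for j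
    proof -
      have jT: "j \<in> carrier T" "j \<in> K" using j I'K KT by auto
      have "i \<otimes> h j = h (i \<otimes> j)" using iT j by (simp add: h_mult)
      also have "\<dots> = h (j \<otimes> i)" using iT jT by (simp add: T.m_comm)
      also have "\<dots> = h i \<otimes> j" using jT i by (simp add: h_mult h_closed T.m_comm)
      finally show ?thesis .
    qed
    have "i \<otimes> u = s \<otimes> (i \<otimes> h a') \<oplus> t \<otimes> (i \<otimes> h b')"
      using iT abT st by (simp add: u_def a' b' T.r_distr T.m_ac)
    also have "\<dots> = s \<otimes> (h i \<otimes> a') \<oplus> t \<otimes> (h i \<otimes> b')"
      by (simp only: sw[OF a'(1)] sw[OF b'(1)])
    also have "\<dots> = h i \<otimes> (s \<otimes> a' \<oplus> t \<otimes> b')"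
      using cT st(1,2) h_closed[OF i] by (simp add: T.r_distr T.m_ac)
    finally show ?thesis unfolding st(3) using h_closed[OF i] by simp
  qed
  have cc: "c \<in> carrier T" "\<And>x. x \<in> carrier T \<Longrightarrow> c \<otimes> x = \<zero> \<Longrightarrow> x = \<zero>"
    using C(4) by (auto simp: non_zero_divisor_def)
  \<comment> \<open>The factor \<open>c\<close> brings an annihilator \<open>w\<close> of
    \<open>u\<close> into \<open>I'\<close>: the coefficients \<open>c w s\<close> and
    \<open>c w t\<close> lie in \<open>C\<close>, hence in \<open>K\<close>. There \<open>h\<close>
    sends \<open>c w\<close> to \<open>c w u = \<zero>\<close>, so injectivity gives
    \<open>c w = \<zero>\<close>, and \<open>c\<close> cancels.\<close>
  have "w = \<zero>" if w: "w \<in> carrier T" "u \<otimes> w = \<zero>" for w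
  proof -
    have CK: "C \<subseteq> K" using ideal.Icarr[OF C(1)] by (auto simp: Rs)
    have "c \<otimes> w \<otimes> s \<in> K" "c \<otimes> w \<otimes> t \<in> K"
      using CK CT.I_r_closed C(3) w(1) st(1,2) by auto
    hence "c \<otimes> w \<otimes> s \<otimes> a' \<oplus> c \<otimes> w \<otimes> t \<otimes> b' \<in> I'"
      by (intro I'_add I'_mult a'(1) b'(1))
    moreover have "c \<otimes> w \<otimes> s \<otimes> a' \<oplus> c \<otimes> w \<otimes> t \<otimes> b' = c \<otimes> w \<otimes> (s \<otimes> a' \<oplus> t \<otimes> b')"
      using cc(1) w(1) st(1,2) cT by (simp add: T.r_distr T.m_assoc)
    ultimately have cw: "c \<otimes> w \<in> I'" unfolding st(3) using cc(1) w(1) by simp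
    have z: "\<zero> \<in> I'" using I'.zero_closed by (simp add: Rs)
    have "h (c \<otimes> w) = c \<otimes> (u \<otimes> w)" using hu[OF cw] cc(1) w(1) u by (simp add: T.m_ac)
    also have "\<dots> = h \<zero>" using hu[OF z] w cc(1) u by simp
    finally have "c \<otimes> w = \<zero>" using h(2) cw z unfolding bij_betw_def inj_on_def by blast
    thus "w = \<zero>" using cc(2) w(1) by blast
  qed
  hence "non_zero_divisor T u" using u by (simp add: non_zero_divisor_def)
  moreover have "a' \<in> K" "b' \<in> K" using a' b' I'K by auto
  moreover have "a = a' \<otimes> u" "b = b' \<otimes> u" using hu a' b' by auto
  ultimately show thesis using st that by blast
qed

text \<open>From here on the argument concerns syzygies of pairs of elements; ideals and their
  presentations are left behind.\<close>

lemma finite_conductor_ring_iff: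
  "finite_conductor_ring R \<longleftrightarrow> cring R \<and> (\<forall>a\<in>carrier R. \<forall>b\<in>carrier R.
    finitely_generated_submodule R (free_module R 2) (syzygies R a b))"
proof -
  have "finite_conductor_ring R \<longleftrightarrow> cring R \<and> (\<forall>a\<in>carrier R. \<forall>b\<in>carrier R.
      finitely_presented_module R (as_module R (Idl\<^bsub>R\<^esub> {a, b})))"
    unfolding finite_conductor_ring_def two_generated_ideal_def by metis
  thus ?thesis using finitely_presented_pair_ideal_iff[of R] by (simp cong: conj_cong)
qed

section \<open>Transfer of finite generation from \<open>A\<close> to \<open>R\<close> and
  \<open>T\<close>\<close>

theorem theorem4p4:
  fixes R T :: "'a ring" and A B :: "'a set ring" and C :: "'a set"
  assumes "regular_conductor_square R T A B C"
    and "flat_module R (as_module T (carrier T))"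
    and "principalideal C T"
    and "\<And>I. two_generated_ideal I R \<Longrightarrow> I \<noteq> {\<zero>\<^bsub>R\<^esub>} \<Longrightarrow>
           \<exists>I'. ideal I' R \<and> module_isomorphic R (as_module R I') (as_module R I)
              \<and> Idl\<^bsub>T\<^esub> I' = carrier T"
    and "finite_conductor_ring A"
  shows "finite_conductor_ring R \<and> finite_conductor_ring T"
proof -
  have T: "cring T" and subR: "subring (carrier R) T" and RT: "R = T\<lparr>carrier := carrier R\<rparr>"
    and CR: "ideal C R" and CT: "ideal C T" and A: "A = R Quot C"
    using assms(1) unfolding regular_conductor_square_def conductor_square_def is_conductor_def
      common_ideal_def by auto
  obtain c where c: "c \<in> C" "non_zero_divisor T c"
    using assms(1) unfolding regular_conductor_square_def by blast
  define K where "K = carrier R"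
  interpret T: cring T by fact
  have Rs: "carrier R = K" "monoid.mult R = monoid.mult T" "ring.add R = ring.add T"
    "one R = one T" "ring.zero R = ring.zero T"
    by (subst RT, simp add: K_def)+
  have KT: "K \<subseteq> carrier T" using T.subcringI'[OF subR] subcringE(1) K_def by blast
  have cR: "cring R"
    using T.subcring_iff[OF KT] T.subcringI'[OF subR] RT K_def by metis
  interpret R: cring R by fact
  interpret CT: ideal C T by fact
  interpret CR: ideal C R by fact
  have CK: "C \<subseteq> K" using CR.Icarr by (auto simp: Rs)
  let ?\<pi> = "(+>\<^bsub>R\<^esub>) C"
  have pi: "ring_hom_cring R A ?\<pi>" unfolding A by (rule CR.rcos_ring_hom_cring[OF cR])
  interpret pi: ring_hom_cring R A ?\<pi> by (rule pi)
  have surj: "?\<pi> ` carrier R = carrier A"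
    unfolding A FactRing_def A_RCOSETS_def' by auto
  have ker: "a_kernel R A ?\<pi> = C"
    unfolding a_kernel_eq A FactRing_def
    using CR.Icarr CR.a_rcos_const CR.rcos_const_imp_mem by auto
  \<comment> \<open>The defining equation reads the same in both rings, so syzygies over
    \<open>R\<close> can be computed in \<open>T\<close>.\<close>
  have syzR: "syzygies R a b = carrier (free_module R 2) \<inter> syzygies T a b" for a b
    using KT by (auto simp: syzygies_def free_module_simps Rs)
  \<comment> \<open>The condition on 2-generated ideals enters here, for any non-zero pair in
    \<open>R\<close>; the scaling factor \<open>u\<close> is only known to lie in
    \<open>T\<close>.\<close>
  have scale: "\<exists>a' b' s t u. a' \<in> K \<and> b' \<in> K \<and> s \<in> carrier T \<and> t \<in> carrier T \<and>
      s \<otimes>\<^bsub>T\<^esub> a' \<oplus>\<^bsub>T\<^esub> t \<otimes>\<^bsub>T\<^esub> b' = \<one>\<^bsub>T\<^esub> \<and> non_zero_divisor T u \<and>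
      a = a' \<otimes>\<^bsub>T\<^esub> u \<and> b = b' \<otimes>\<^bsub>T\<^esub> u"
    if ab: "a \<in> K" "b \<in> K" "a \<noteq> \<zero>\<^bsub>T\<^esub> \<or> b \<noteq> \<zero>\<^bsub>T\<^esub>" for a b
  proof -
    have "{a, b} \<subseteq> Idl\<^bsub>R\<^esub> {a, b}" using ab by (intro R.genideal_self) (auto simp: Rs)
    hence "Idl\<^bsub>R\<^esub> {a, b} \<noteq> {\<zero>\<^bsub>R\<^esub>}" using ab(3) by (auto simp: Rs)
    moreover have "two_generated_ideal (Idl\<^bsub>R\<^esub> {a, b}) R"
      using ab unfolding two_generated_ideal_def Rs by blast
    ultimately obtain I' where I': "ideal I' R"
      "module_isomorphic R (as_module R I') (as_module R (Idl\<^bsub>R\<^esub> {a, b}))"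
      "Idl\<^bsub>T\<^esub> I' = carrier T" using assms(4) by blast
    have RK: "T\<lparr>carrier := K\<rparr> = R" using RT K_def by simp
    show ?thesis
      by (rule isomorphic_ideal_scaling[of T K C c a b I', unfolded RK])
        (use T subR CR CT c ab I' K_def in blast)+
  qed
  have "finitely_generated_submodule R (free_module R 2) (syzygies R a b)"
    if ab: "a \<in> K" "b \<in> K" for a b
  proof (cases "a = \<zero>\<^bsub>T\<^esub> \<and> b = \<zero>\<^bsub>T\<^esub>")
    case True
    thus ?thesis using syzygies_zero_fg[OF cR] by (simp add: Rs)
  next
    case False
    then obtain a' b' s t u where
      a': "a' \<in> K" "b' \<in> K" and st: "s \<in> carrier T" "t \<in> carrier T"
      "s \<otimes>\<^bsub>T\<^esub> a' \<oplus>\<^bsub>T\<^esub> t \<otimes>\<^bsub>T\<^esub> b' = \<one>\<^bsub>T\<^esub>" and u: "non_zero_divisor T u"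
      "a = a' \<otimes>\<^bsub>T\<^esub> u" "b = b' \<otimes>\<^bsub>T\<^esub> u"
      using scale[OF ab] by blast
    have aT: "a' \<in> carrier T" "b' \<in> carrier T" using a' KT by auto
    \<comment> \<open>The factor \<open>u\<close> is cancelled over \<open>T\<close>, and the result
      is then restricted to vectors over \<open>R\<close>.\<close>
    have eq: "syzygies R a b = syzygies R a' b'"
      unfolding syzR u(2,3) T.syzygies_scale[OF aT u(1)] ..
    have "\<ominus>\<^bsub>T\<^esub> a' \<in> K" using subringE(5)[OF subR] a' K_def by blast
    hence k: "vec2 b' (\<ominus>\<^bsub>T\<^esub> a') \<in> syzygies R a' b'"
      unfolding syzR using T.syzygies_unimodular_generator[OF aT] a'
      by (auto intro!: vec2_closed simp: Rs)
    show ?thesis unfolding eq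
    proof (rule syzygies_descent[OF pi surj _ _ _ k, unfolded ker Rs, OF a'])
      fix d assume d: "d \<in> C"
      have dT: "d \<in> carrier T" using d CK KT by auto
      \<comment> \<open>\<open>s\<close> and \<open>t\<close> may lie outside \<open>R\<close>, but
        \<open>C\<close> is an ideal of \<open>T\<close>, so \<open>d s\<close> and
        \<open>d t\<close> are again in \<open>C\<close>.\<close>
      have "d = d \<otimes>\<^bsub>T\<^esub> (s \<otimes>\<^bsub>T\<^esub> a' \<oplus>\<^bsub>T\<^esub> t \<otimes>\<^bsub>T\<^esub> b')" unfolding st(3) using dT by simp
      also have "\<dots> = d \<otimes>\<^bsub>T\<^esub> s \<otimes>\<^bsub>T\<^esub> a' \<oplus>\<^bsub>T\<^esub> d \<otimes>\<^bsub>T\<^esub> t \<otimes>\<^bsub>T\<^esub> b'"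
        using dT st(1,2) aT by (simp add: T.r_distr T.m_assoc)
      finally show "\<exists>p\<in>C. \<exists>q\<in>C. d = p \<otimes>\<^bsub>T\<^esub> a' \<oplus>\<^bsub>T\<^esub> q \<otimes>\<^bsub>T\<^esub> b'"
        using CT.I_r_closed[OF d] st(1,2) by blast
    next
      fix x assume x: "x \<in> syzygies R a' b'" "x 0 \<in> C" "x 1 \<in> C"
      let ?w = "t \<otimes>\<^bsub>T\<^esub> x 0 \<ominus>\<^bsub>T\<^esub> s \<otimes>\<^bsub>T\<^esub> x 1"
      \<comment> \<open>The factor is a \<open>T\<close>-combination of the entries of
        \<open>x\<close>, which lie in \<open>C\<close>; so it is in \<open>C\<close> and hence a
        scalar of \<open>R\<close>.\<close>
      have "?w \<in> C" unfolding a_minus_def using x(2,3) st(1,2) CT.I_l_closed by simp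
      moreover have "x = ?w \<odot>\<^bsub>free_module T 2\<^esub> vec2 b' (\<ominus>\<^bsub>T\<^esub> a')"
        using x(1) syzR by (intro T.syzygies_unimodular[OF aT st]) auto
      ultimately show "\<exists>r\<in>K. x = r \<odot>\<^bsub>free_module R 2\<^esub> vec2 b' (\<ominus>\<^bsub>T\<^esub> a')"
        using CK by (auto simp: free_module_simps Rs)
    next
      show "finitely_generated_submodule A (free_module A 2) (syzygies A (?\<pi> a') (?\<pi> b'))"
        using assms(5) a' unfolding finite_conductor_ring_iff by (simp add: Rs)
    qed
  qed
  moreover have "finitely_generated_submodule T (free_module T 2) (syzygies T a b)"
    if ab: "a \<in> carrier T" "b \<in> carrier T" for a b
  proof (cases "a = \<zero>\<^bsub>T\<^esub> \<and> b = \<zero>\<^bsub>T\<^esub>")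
    case True
    thus ?thesis using syzygies_zero_fg[OF T] by simp
  next
    case False
    have cc: "c \<in> carrier T" "\<And>x. x \<in> carrier T \<Longrightarrow> c \<otimes>\<^bsub>T\<^esub> x = \<zero>\<^bsub>T\<^esub> \<Longrightarrow> x = \<zero>\<^bsub>T\<^esub>"
      using c(2) by (auto simp: non_zero_divisor_def)
    \<comment> \<open>Multiplication by \<open>c\<close> moves the pair into \<open>C\<close>, hence
      into \<open>R\<close>. As \<open>c\<close> is a non-zero-divisor, the pair stays non-zero and
      keeps its syzygies over \<open>T\<close>.\<close>
    have "a \<otimes>\<^bsub>T\<^esub> c \<in> K" "b \<otimes>\<^bsub>T\<^esub> c \<in> K" using CK CT.I_l_closed c(1) ab by auto
    moreover have "a \<otimes>\<^bsub>T\<^esub> c \<noteq> \<zero>\<^bsub>T\<^esub> \<or> b \<otimes>\<^bsub>T\<^esub> c \<noteq> \<zero>\<^bsub>T\<^esub>"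
      using False cc ab T.m_comm by metis
    ultimately obtain a' b' s t u where
      a': "a' \<in> K" "b' \<in> K" and st: "s \<in> carrier T" "t \<in> carrier T"
      "s \<otimes>\<^bsub>T\<^esub> a' \<oplus>\<^bsub>T\<^esub> t \<otimes>\<^bsub>T\<^esub> b' = \<one>\<^bsub>T\<^esub>" and u: "non_zero_divisor T u"
      "a \<otimes>\<^bsub>T\<^esub> c = a' \<otimes>\<^bsub>T\<^esub> u" "b \<otimes>\<^bsub>T\<^esub> c = b' \<otimes>\<^bsub>T\<^esub> u"
      using scale by blast
    have aT: "a' \<in> carrier T" "b' \<in> carrier T" using a' KT by auto
    \<comment> \<open>The pair multiplied by \<open>c\<close> is the pair \<open>a'\<close>,
      \<open>b'\<close> multiplied by \<open>u\<close>, and both factors cancel.\<close>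
    have "syzygies T a b = syzygies T a' b'"
      using T.syzygies_scale[OF ab c(2)] T.syzygies_scale[OF aT u(1)] u(2,3) by simp
    thus ?thesis using syzygies_unimodular_fg[OF T aT st] by simp
  qed
  ultimately show ?thesis unfolding finite_conductor_ring_iff using cR T by (simp add: Rs)
qed

end
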